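(* Any distributed algorithm in the CONGEST model for the problem DSF-CR with finite approximation ratio has (worst-case) time complexity $\Omega(t/\log n)$. This is true even in graphs with diameter at most $4$ and for instances with no more than two input components.
   Context: CONGEST model: the network is a connected weighted graph $G=(V,E,W)$ with $n=|V|$ nodes and weights $W:E\to\mathbb N$ (positive integers) bounded by a polynomial in $n$. Each node initially knows its unique $\mathcal O(\log n)$-bit identifier, the identifiers of its neighbors, the weights of its incident edges, and its local problem-specific input. Algorithms proceed in synchronous rounds; in each round nodes perform arbitrary finite local computation, may send to each neighbor a (possibly distinct) message of $\mathcal O(\log n)$ bits, and receive the messages sent by their neighbors. Time complexity is the number of rounds until all nodes have explicitly terminated. "Diameter" is the unweighted (hop) diameter. DSF-CR (Distributed Steiner Forest with Connection Requests): each node $v$ gets as input a set $R_v\subseteq V$ of connection requests (not required to be symmetric). A solution is an edge set $F\subseteq E$ such that for every $v$ and every $w\in R_v$, $v$ and $w$ are connected by $F$; its weight is $W(F)=\sum_{e\in F}W(e)$. Each node must output which of its incident edges are in $F$. The set of terminals is $T=\{w: w\in R_v\text{ for some }v\}\cup\{v:R_v\neq\emptyset\}$, and $t=|T|$. The input components are the connected components of the graph on $T$ with edges $\{v,w\}$ for $w\in R_v$. An algorithm has finite approximation ratio if there is a finite $\rho$ such that its output is always a solution of weight at most $\rho$ times the minimum weight of a solution. The bound is worst-case: there are families of instances with $t/\log n\to\infty$ (satisfying the stated restrictions on diameter and number of input components) on which the number of rounds is $\Omega(t/\log n)$. *)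

theory Defs
  imports Complex_Main "HOL-Library.Landau_Symbols"
begin

(* Nodes are identified with their unique identifiers, which are natural numbers;
   an undirected edge is a two-element set of nodes. *)

record dsf_instance =
  nodes    :: "nat set"
  edges    :: "nat set set"
  weight   :: "nat set \<Rightarrow> nat"
  requests :: "nat \<Rightarrow> nat set"

abbreviation num_nodes :: "dsf_instance \<Rightarrow> nat" where
  "num_nodes I \<equiv> card (nodes I)"

definition adjacency :: "nat set set \<Rightarrow> (nat \<times> nat) set" where
  "adjacency F = {(u, v). {u, v} \<in> F}"

definition connected_by :: "nat set set \<Rightarrow> nat \<Rightarrow> nat \<Rightarrow> bool" where
  "connected_by F u v \<longleftrightarrow> (u, v) \<in> (adjacency F)\<^sup>*"

(* The constants a and d are the exponents hidden in "identifiers of O(log n) bits"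
   (identifiers are smaller than n^a) and "weights bounded by a polynomial in n"
   (weights are at most n^d). *)
definition dsf_cr_instance :: "nat \<Rightarrow> nat \<Rightarrow> dsf_instance \<Rightarrow> bool" where
  "dsf_cr_instance a d I \<longleftrightarrow>
     finite (nodes I) \<and> nodes I \<noteq> {} \<and>
     (\<forall>v \<in> nodes I. v < num_nodes I ^ a) \<and>
     (\<forall>e \<in> edges I. e \<subseteq> nodes I \<and> card e = 2) \<and>
     (\<forall>u \<in> nodes I. \<forall>v \<in> nodes I. connected_by (edges I) u v) \<and>
     (\<forall>e \<in> edges I. 1 \<le> weight I e \<and> weight I e \<le> num_nodes I ^ d) \<and>
     (\<forall>v \<in> nodes I. requests I v \<subseteq> nodes I)"

definition hop_distance :: "dsf_instance \<Rightarrow> nat \<Rightarrow> nat \<Rightarrow> nat" where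
  "hop_distance I u v = (LEAST k. (u, v) \<in> adjacency (edges I) ^^ k)"

definition hop_diameter :: "dsf_instance \<Rightarrow> nat" where
  "hop_diameter I = Max ((\<lambda>(u, v). hop_distance I u v) ` (nodes I \<times> nodes I))"

definition terminals :: "dsf_instance \<Rightarrow> nat set" where
  "terminals I = {w. \<exists>v \<in> nodes I. w \<in> requests I v} \<union> {v \<in> nodes I. requests I v \<noteq> {}}"

abbreviation num_terminals :: "dsf_instance \<Rightarrow> nat" where
  "num_terminals I \<equiv> card (terminals I)"

definition request_edges :: "dsf_instance \<Rightarrow> nat set set" where
  "request_edges I = {{v, w} | v w. v \<in> nodes I \<and> w \<in> requests I v}"

definition input_components :: "dsf_instance \<Rightarrow> nat set set" where
  "input_components I = terminals I // (adjacency (request_edges I))\<^sup>*"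

definition solution :: "dsf_instance \<Rightarrow> nat set set \<Rightarrow> bool" where
  "solution I F \<longleftrightarrow> F \<subseteq> edges I \<and>
     (\<forall>v \<in> nodes I. \<forall>w \<in> requests I v. connected_by F v w)"

definition total_weight :: "dsf_instance \<Rightarrow> nat set set \<Rightarrow> nat" where
  "total_weight I F = (\<Sum>e\<in>F. weight I e)"

definition opt_weight :: "dsf_instance \<Rightarrow> nat" where
  "opt_weight I = Min (total_weight I ` {F. solution I F})"

(* The initial knowledge of a node. The domain of view_nbrs is the set of identifiers of
   the neighbors, and its values are the weights of the corresponding incident edges. *)
record node_view =
  view_id       :: nat
  view_nbrs     :: "nat \<rightharpoonup> nat"
  view_requests :: "nat set"

definition node_view_of :: "dsf_instance \<Rightarrow> nat \<Rightarrow> node_view" where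
  "node_view_of I v =
     \<lparr>view_id = v,
      view_nbrs = (\<lambda>w. if {v, w} \<in> edges I then Some (weight I {v, w}) else None),
      view_requests = requests I v\<rparr>"

(* A deterministic algorithm whose local computations are arbitrary functions on an arbitrary
   type of local states. send s w is the bit string sent to neighbor w (None: no message);
   receive s m is the state after receiving m u from each neighbor u. result s = None means
   that the node has not terminated yet; result s = Some S means that it has terminated and
   selects exactly the edges leading to the neighbors in S. *)
record 's algorithm =
  init    :: "node_view \<Rightarrow> 's"
  send    :: "'s \<Rightarrow> nat \<Rightarrow> bool list option"
  receive :: "'s \<Rightarrow> (nat \<Rightarrow> bool list option) \<Rightarrow> 's"
  result  :: "'s \<Rightarrow> nat set option"

definition sent :: "'s algorithm \<Rightarrow> dsf_instance \<Rightarrow> (nat \<Rightarrow> 's) \<Rightarrow> nat \<Rightarrow> nat \<Rightarrow> bool list option" where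
  "sent A I \<sigma> u v =
     (if {u, v} \<in> edges I \<and> result A (\<sigma> u) = None then send A (\<sigma> u) v else None)"

(* The local states after r rounds; terminated nodes send nothing and keep their state. *)
primrec states :: "'s algorithm \<Rightarrow> dsf_instance \<Rightarrow> nat \<Rightarrow> nat \<Rightarrow> 's" where
  "states A I 0 = (\<lambda>v. init A (node_view_of I v))"
| "states A I (Suc r) = (\<lambda>v.
     if result A (states A I r v) = None
     then receive A (states A I r v) (\<lambda>u. sent A I (states A I r) u v)
     else states A I r v)"

definition all_terminated :: "'s algorithm \<Rightarrow> dsf_instance \<Rightarrow> nat \<Rightarrow> bool" where
  "all_terminated A I r \<longleftrightarrow> (\<forall>v \<in> nodes I. result A (states A I r v) \<noteq> None)"

definition rounds :: "'s algorithm \<Rightarrow> dsf_instance \<Rightarrow> nat" where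
  "rounds A I = (LEAST r. all_terminated A I r)"

(* The algorithm terminates on I and the outputs of all nodes consistently describe F. *)
definition computes :: "'s algorithm \<Rightarrow> dsf_instance \<Rightarrow> nat set set \<Rightarrow> bool" where
  "computes A I F \<longleftrightarrow> (\<exists>r. all_terminated A I r) \<and>
     (\<forall>v \<in> nodes I. result A (states A I (rounds A I) v) = Some {w. {v, w} \<in> F})"

definition congest_algorithm :: "nat \<Rightarrow> nat \<Rightarrow> 's algorithm \<Rightarrow> bool" where
  "congest_algorithm a d A \<longleftrightarrow>
     (\<exists>c :: real. \<forall>I. dsf_cr_instance a d I \<longrightarrow>
        (\<forall>r u v m. u \<in> nodes I \<longrightarrow> v \<in> nodes I \<longrightarrow>
           sent A I (states A I r) u v = Some m \<longrightarrow>
           real (length m) \<le> c * log 2 (real (num_nodes I))))"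

definition finite_approx_ratio :: "nat \<Rightarrow> nat \<Rightarrow> 's algorithm \<Rightarrow> bool" where
  "finite_approx_ratio a d A \<longleftrightarrow>
     (\<exists>\<rho> :: real. \<forall>I. dsf_cr_instance a d I \<longrightarrow>
        (\<exists>F. computes A I F \<and> solution I F \<and>
             real (total_weight I F) \<le> \<rho> * real (opt_weight I)))"

end

theory Submission
  imports Defs "HOL-Real_Asymp.Real_Asymp"
begin

text \<open>Reduction from set disjointness. Node 0 requests a set \<open>S\<close> of leaves; every leaf hangs on
  one of the two hubs 1 and 2, and the leaves in \<open>T\<close> are those on hub 2. Node 0 is joined to hub 1
  only, and the hubs are joined by an edge so heavy that an approximate solution contains it exactly
  if \<open>S\<close> meets \<open>T\<close>. Node 0 knows \<open>S\<close> but not \<open>T\<close>, the others know \<open>T\<close> but not \<open>S\<close>, and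
  all communication between them crosses the edge \<open>{0, 1}\<close>. The \<open>2 ^ k\<close> pairs \<open>(S, - S)\<close> form a
  fooling set: if two of them had the same communication over that edge, one of the two mixed
  instances would be solved without its necessary heavy edge. Hence on one of these pairs the
  communication over \<open>{0, 1}\<close> has on the order of \<open>k\<close> bits.\<close>

section \<open>Executions\<close>

lemma states_stable:
  assumes "result A (states A I r v) \<noteq> None" "r \<le> r'"
  shows "states A I r' v = states A I r v"
  using assms(2,1) by (induction r' rule: dec_induct) auto

text \<open>A terminated node is frozen, so \<open>r\<close> may lie before or after
  \<open>rounds A I\<close>, which waits for the slowest node.\<close>

lemma computes_result:
  assumes "computes A I F" "v \<in> nodes I" "result A (states A I r v) = Some X"
  shows "X = {w. {v, w} \<in> F}"
proof -
  have *: "result A (states A I (rounds A I) v) = Some {w. {v, w} \<in> F}"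
    using assms(1,2) by (simp add: computes_def)
  have "states A I r v = states A I (rounds A I) v"
    using states_stable[of A I r v "rounds A I"] states_stable[of A I "rounds A I" v r] * assms(3)
    by (metis nle_le option.distinct(1))
  with * assms(3) show ?thesis by simp
qed

lemma computes_result_after_rounds:
  assumes "computes A I F" "v \<in> nodes I" "rounds A I \<le> r"
  shows "result A (states A I r v) = Some {w. {v, w} \<in> F}"
proof -
  have "result A (states A I (rounds A I) v) = Some {w. {v, w} \<in> F}"
    using assms(1,2) by (simp add: computes_def)
  with states_stable[of A I "rounds A I" v r] assms(3) show ?thesis by simp
qed

section \<open>The instances\<close>

definition graph_order :: "nat \<Rightarrow> nat" where
  "graph_order k = (2 * k + 3)\<^sup>2"

text \<open>This is the parent function of a tree rooted at node 1. For \<open>T\<close> a set of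
  leaves, 2 is outside \<open>T\<close>, so the edge from 2 to its parent is the heavy one.\<close>

definition hub :: "nat set \<Rightarrow> nat \<Rightarrow> nat" where
  "hub T v = (if v \<in> T then 2 else 1)"

definition leaves :: "nat \<Rightarrow> nat set" where
  "leaves k = {3..<3 + k}"

text \<open>The leaves in \<open>{3 + k..<3 + 2 * k}\<close> are always requested, so that there are at least \<open>k\<close>
  terminals whatever \<open>S\<close> is. The remaining nodes only make the order quadratic in \<open>k\<close>, so that a
  weight linear in the order exceeds any constant multiple of the number of terminals.\<close>
definition disj_instance :: "nat \<Rightarrow> nat set \<Rightarrow> nat set \<Rightarrow> dsf_instance" where
  "disj_instance k S T =
     \<lparr>nodes = {..<graph_order k},
      edges = {{v, hub T v} | v. v < graph_order k \<and> v \<noteq> 1},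
      weight = (\<lambda>e. if e = {1, 2} then graph_order k else 1),
      requests = (\<lambda>v. if v = 0 then S \<union> {3 + k..<3 + 2 * k} else {})\<rparr>"

lemma disj_instance_simps [simp]:
  "nodes (disj_instance k S T) = {..<graph_order k}"
  "edges (disj_instance k S T) = {{v, hub T v} | v. v < graph_order k \<and> v \<noteq> 1}"
  "weight (disj_instance k S T) = (\<lambda>e. if e = {1, 2} then graph_order k else 1)"
  "requests (disj_instance k S T) = (\<lambda>v. if v = 0 then S \<union> {3 + k..<3 + 2 * k} else {})"
  by (simp_all add: disj_instance_def)

lemma graph_order_ge: "2 * k + 3 \<le> graph_order k"
  by (simp add: graph_order_def power2_eq_square)

lemma leaf_less_graph_order: "v \<in> leaves k \<Longrightarrow> v < graph_order k"
  using graph_order_ge[of k] by (simp add: leaves_def)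

lemma hub_neq:
  assumes "T \<subseteq> leaves k" "v \<noteq> 1"
  shows "hub T v \<noteq> v"
  using assms by (auto simp: hub_def leaves_def)

lemma hub_less_graph_order: "hub T v < graph_order k"
  using graph_order_ge[of k] by (simp add: hub_def)

text \<open>Node 0 lies outside \<open>T\<close> and is no hub, so its neighbourhood is the same for
  all \<open>T\<close>. Hence its view does not reveal \<open>T\<close>, and all its traffic uses
  one edge.\<close>

lemma zero_edge_iff:
  assumes "T \<subseteq> leaves k"
  shows "{0, w} \<in> edges (disj_instance k S T) \<longleftrightarrow> w = 1"
    and "{w, 0} \<in> edges (disj_instance k S T) \<longleftrightarrow> w = 1"
proof -
  show "{0, w} \<in> edges (disj_instance k S T) \<longleftrightarrow> w = 1"
  proof
    assume "{0, w} \<in> edges (disj_instance k S T)"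
    then show "w = 1"
      using assms by (auto simp: hub_def leaves_def doubleton_eq_iff split: if_splits)
  next
    assume "w = 1"
    moreover have "hub T 0 = 1" using assms by (auto simp: hub_def leaves_def)
    ultimately show "{0, w} \<in> edges (disj_instance k S T)"
      using graph_order_ge[of k] by force
  qed
  then show "{w, 0} \<in> edges (disj_instance k S T) \<longleftrightarrow> w = 1"
    by (simp add: insert_commute)
qed

section \<open>Hop diameter, validity, terminals and components of the instances\<close>

lemma sym_adjacency: "sym (adjacency F)"
  by (auto simp: sym_def adjacency_def insert_commute)

lemma adjacency_hub:
  assumes "v < graph_order k" "v \<noteq> 1"
  shows "(v, hub T v) \<in> adjacency (edges (disj_instance k S T))"
  using assms by (auto simp: adjacency_def)

text \<open>The tree has depth at most 2. Two such climbs, joined at the root, give the diameter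
  bound 4.\<close>

lemma path_to_hub:
  assumes "T \<subseteq> leaves k" "v < graph_order k"
  shows "\<exists>j\<le>2. (v, 1) \<in> adjacency (edges (disj_instance k S T)) ^^ j"
proof -
  let ?R = "adjacency (edges (disj_instance k S T))"
  consider "v = 1" | "v \<noteq> 1" "v \<notin> T" | "v \<noteq> 1" "v \<in> T" by blast
  then show ?thesis
  proof cases
    case 1
    then show ?thesis by (intro exI[of _ 0]) simp
  next
    case 2
    then have "(v, 1) \<in> ?R"
      using adjacency_hub[OF assms(2), of T S] by (simp add: hub_def)
    then show ?thesis by (intro exI[of _ 1]) simp
  next
    case 3
    have "2 \<notin> T" using assms(1) by (auto simp: leaves_def)
    then have "(2, 1) \<in> ?R"
      using adjacency_hub[of 2 k T S] graph_order_ge[of k] by (simp add: hub_def)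
    moreover have "(v, 2) \<in> ?R"
      using 3 adjacency_hub[OF assms(2), of T S] by (simp add: hub_def)
    ultimately have "(v, 1) \<in> ?R ^^ 2" by (auto simp: numeral_2_eq_2)
    then show ?thesis by blast
  qed
qed

lemma relpow_sym:
  assumes "sym R" "(x, y) \<in> R ^^ j"
  shows "(y, x) \<in> R ^^ j"
  using assms(2)
proof (induction j arbitrary: y)
  case (Suc j)
  then obtain z where "(x, z) \<in> R ^^ j" "(z, y) \<in> R" by auto
  with Suc.IH assms(1) show ?case
    by (meson relpow_Suc_I2 symD)
qed simp

lemma short_path:
  assumes "T \<subseteq> leaves k" "u < graph_order k" "v < graph_order k"
  shows "\<exists>j\<le>4. (u, v) \<in> adjacency (edges (disj_instance k S T)) ^^ j"
proof -
  let ?R = "adjacency (edges (disj_instance k S T))"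
  obtain i j where ij: "i \<le> 2" "(u, 1) \<in> ?R ^^ i" "j \<le> 2" "(v, 1) \<in> ?R ^^ j"
    using path_to_hub[OF assms(1,2)] path_to_hub[OF assms(1,3)] by metis
  have "(1, v) \<in> ?R ^^ j" using ij(4) by (rule relpow_sym[OF sym_adjacency])
  with ij(2) have "(u, v) \<in> ?R ^^ (i + j)"
    unfolding relpow_add by blast
  with ij(1,3) show ?thesis by (intro exI[of _ "i + j"]) simp
qed

lemma hop_diameter_disj_instance:
  assumes "T \<subseteq> leaves k"
  shows "hop_diameter (disj_instance k S T) \<le> 4"
proof -
  have "hop_distance (disj_instance k S T) u v \<le> 4" if "u < graph_order k" "v < graph_order k" for u v
    unfolding hop_distance_def using short_path[OF assms that, of S]
    by (meson Least_le order_trans)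
  moreover have "0 \<in> {..<graph_order k}" using graph_order_ge[of k] by simp
  then have "{..<graph_order k} \<times> {..<graph_order k} \<noteq> {}" by blast
  ultimately show ?thesis
    unfolding hop_diameter_def by (subst Max_le_iff) auto
qed

text \<open>Identifiers lie below the number of nodes and weights do not exceed it, so all exponents
  from 1 on are admissible.\<close>

lemma dsf_cr_disj_instance:
  assumes "1 \<le> a" "1 \<le> d" "S \<subseteq> leaves k" "T \<subseteq> leaves k"
  shows "dsf_cr_instance a d (disj_instance k S T)"
proof -
  let ?I = "disj_instance k S T"
  have pow: "graph_order k \<le> graph_order k ^ e" if "1 \<le> e" for e
    using that graph_order_ge[of k] by (intro self_le_power) auto
  have "connected_by (edges ?I) u v" if "u < graph_order k" "v < graph_order k" for u v
    unfolding connected_by_def using short_path[OF assms(4) that, of S]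
    by (blast intro: relpow_imp_rtrancl)
  moreover have "e \<subseteq> nodes ?I \<and> card e = 2" if "e \<in> edges ?I" for e
    using that hub_less_graph_order[of T _ k] hub_neq[OF assms(4)] by (auto simp: card_2_iff)
  moreover have "1 \<le> graph_order k ^ d" "1 \<le> graph_order k" using graph_order_ge[of k] by auto
  moreover have "S \<union> {3 + k..<3 + 2 * k} \<subseteq> {..<graph_order k}"
    using assms(3) graph_order_ge[of k] leaf_less_graph_order by fastforce
  moreover have "v < graph_order k ^ a" if "v < graph_order k" for v
    using that pow[OF assms(1)] by linarith
  moreover have "graph_order k \<le> graph_order k ^ d" using pow[OF assms(2)] .
  moreover have "nodes ?I \<noteq> {}" using graph_order_ge[of k] by (auto simp: lessThan_empty_iff)
  ultimately show ?thesis
    unfolding dsf_cr_instance_def by simp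
qed

lemma terminals_disj_instance:
  "terminals (disj_instance k S T) =
     S \<union> {3 + k..<3 + 2 * k} \<union> (if S \<union> {3 + k..<3 + 2 * k} = {} then {} else {0})"
  using graph_order_ge[of k] by (auto simp: terminals_def split: if_splits)

lemma num_terminals_bounds:
  assumes "S \<subseteq> leaves k"
  shows "k \<le> num_terminals (disj_instance k S T)"
    and "num_terminals (disj_instance k S T) \<le> 2 * k + 1"
proof -
  have sub: "terminals (disj_instance k S T) \<subseteq> insert 0 {3..<3 + 2 * k}"
    using assms unfolding terminals_disj_instance leaves_def by (auto split: if_splits)
  show "num_terminals (disj_instance k S T) \<le> 2 * k + 1"
    using card_mono[OF _ sub] by simp
  have "{3 + k..<3 + 2 * k} \<subseteq> terminals (disj_instance k S T)"
    unfolding terminals_disj_instance by blast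
  from card_mono[OF finite_subset[OF sub] this] show "k \<le> num_terminals (disj_instance k S T)"
    by simp
qed

text \<open>All requests come from node 0, so every terminal lies in the class of 0.\<close>

lemma input_components_disj_instance:
  "card (input_components (disj_instance k S T)) \<le> 2"
proof -
  let ?I = "disj_instance k S T"
  let ?R = "(adjacency (request_edges ?I))\<^sup>*"
  have "?R `` {v} = ?R `` {0}" if "v \<in> terminals ?I" for v
  proof (cases "v = 0")
    case False
    with that have "v \<in> requests ?I 0"
      by (auto simp: terminals_disj_instance split: if_splits)
    then have "{0, v} \<in> request_edges ?I"
      unfolding request_edges_def using graph_order_ge[of k] by fastforce
    then have "(0, v) \<in> adjacency (request_edges ?I)" "(v, 0) \<in> adjacency (request_edges ?I)"
      by (auto simp: adjacency_def insert_commute)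
    then show ?thesis
      by (auto intro: converse_rtrancl_into_rtrancl)
  qed simp
  then have "input_components ?I \<subseteq> {?R `` {0}}"
    unfolding input_components_def quotient_def by auto
  from card_mono[OF _ this] show ?thesis by simp
qed

section \<open>The heavy edge\<close>

text \<open>A cut argument: only the heavy edge leaves the set \<open>insert 2 T\<close>, so a path
  from 0 that avoids this edge never enters the set, whereas \<open>v\<close> belongs to it.\<close>

lemma heavy_edge_necessary:
  assumes "S \<subseteq> leaves k" "T \<subseteq> leaves k" "v \<in> S" "v \<in> T"
    and sol: "solution (disj_instance k S T) F"
  shows "{1, 2} \<in> F"
proof (rule ccontr)
  assume heavy: "{1, 2} \<notin> F"
  have F: "F \<subseteq> {{v, hub T v} | v. v < graph_order k \<and> v \<noteq> 1}"
    using sol by (simp add: solution_def)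
  have "\<forall>w \<in> requests (disj_instance k S T) 0. connected_by F 0 w"
    using sol graph_order_ge[of k] by (simp add: solution_def)
  then have "(0, v) \<in> (adjacency F)\<^sup>*"
    using assms(3) by (simp add: connected_by_def)
  then have "v \<notin> insert 2 T"
  proof (induction rule: rtrancl_induct)
    case base
    then show ?case using assms(2) by (auto simp: leaves_def)
  next
    case (step x y)
    from step.hyps(2) have xy: "{x, y} \<in> F" by (simp add: adjacency_def)
    obtain w where "{x, y} = {w, hub T w}" "w \<noteq> 1"
      using subsetD[OF F xy] by (elim CollectE exE conjE) (rule that)
    \<comment> \<open>The path moves either up to the parent or down to a child.\<close>
    then consider "x = w" "y = hub T w" | "y = w" "x = hub T w" "w \<noteq> 1"
      unfolding doubleton_eq_iff by blast
    then show ?case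
    proof cases
      case 1
      with step.IH have "y = 1" by (simp add: hub_def)
      then show ?thesis using assms(2) by (auto simp: leaves_def)
    next
      case 2
      with step.IH have "y \<notin> T" "x = 1" by (simp_all add: hub_def split: if_splits)
      moreover have "y \<noteq> 2"
      proof
        assume "y = 2"
        with xy \<open>x = 1\<close> have "{1, 2} \<in> F" by simp
        with heavy show False ..
      qed
      ultimately show ?thesis by simp
    qed
  qed
  with assms(4) show False by blast
qed

lemma finite_edges: "finite (edges (disj_instance k S T))"
  by simp

text \<open>Disjointness puts all requested nodes on hub 1, so the star of unit edges from hub 1 to
  them and to 0 is a solution.\<close>

lemma opt_weight_disjoint:
  assumes "S \<subseteq> leaves k" "T \<subseteq> leaves k" "S \<inter> T = {}"
  shows "opt_weight (disj_instance k S T) \<le> 2 * k + 1"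
proof -
  let ?I = "disj_instance k S T"
  define B where "B = insert 0 (requests ?I 0)"
  define F where "F = (\<lambda>v. {v, 1}) ` B"
  have sub: "B \<subseteq> insert 0 {3..<3 + 2 * k}"
    using assms(1) by (fastforce simp: B_def leaves_def)
  then have fin: "finite B" and cB: "card B \<le> 2 * k + 1"
    using finite_subset card_mono[OF _ sub] by auto
  have B: "v < graph_order k \<and> v \<noteq> 1 \<and> v \<noteq> 2 \<and> v \<notin> T" if "v \<in> B" for v
  proof -
    have "v \<notin> T" using that assms by (auto simp: B_def leaves_def)
    moreover have "v \<in> insert 0 {3..<3 + 2 * k}" using that sub by blast
    ultimately show ?thesis using graph_order_ge[of k] by auto
  qed
  have "F \<subseteq> edges ?I"
  proof
    fix e assume "e \<in> F"
    then obtain v where "v \<in> B" "e = {v, 1}" by (auto simp: F_def)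
    with B[of v] show "e \<in> edges ?I" by (auto simp: hub_def)
  qed
  moreover have "connected_by F 0 w" if "w \<in> requests ?I 0" for w
  proof -
    have "(0, 1) \<in> adjacency F" "(1, w) \<in> adjacency F"
      using that by (auto simp: adjacency_def F_def B_def insert_commute)
    then show ?thesis unfolding connected_by_def by (meson r_into_rtrancl rtrancl_trans)
  qed
  ultimately have "solution ?I F" by (auto simp: solution_def)
  moreover have "finite {F. solution ?I F}"
    by (rule finite_subset[of _ "Pow (edges ?I)"]) (auto simp: solution_def)
  ultimately have "opt_weight ?I \<le> total_weight ?I F"
    unfolding opt_weight_def by (intro Min_le) auto
  also have "\<dots> = card F"
  proof -
    have "{1, 2} \<notin> F" using B by (auto simp: F_def doubleton_eq_iff)
    then have "total_weight ?I F = (\<Sum>e\<in>F. 1)"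
      unfolding total_weight_def by (intro sum.cong) auto
    then show ?thesis by simp
  qed
  also have "\<dots> \<le> 2 * k + 1"
    using card_image_le[OF fin, of "\<lambda>v. {v, 1}"] cB unfolding F_def by linarith
  finally show ?thesis .
qed

lemma heavy_edge_avoided:
  fixes \<rho> :: real
  assumes "S \<subseteq> leaves k" "T \<subseteq> leaves k" "S \<inter> T = {}" "\<rho> \<le> real k"
    and sol: "solution (disj_instance k S T) F"
    and approx: "real (total_weight (disj_instance k S T) F)
                  \<le> \<rho> * real (opt_weight (disj_instance k S T))"
  shows "{1, 2} \<notin> F"
proof
  let ?I = "disj_instance k S T"
  assume heavy: "{1, 2} \<in> F"
  have "finite F"
    using sol finite_edges by (auto simp: solution_def intro: finite_subset)
  with heavy have "weight ?I {1, 2} \<le> total_weight ?I F"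
    unfolding total_weight_def by (intro member_le_sum) auto
  then have "real (graph_order k) \<le> real (total_weight ?I F)" by simp
  also note approx
  also have "\<rho> * real (opt_weight ?I) \<le> real k * real (2 * k + 1)"
    using assms(4) opt_weight_disjoint[OF assms(1-3)]
    by (intro mult_mono) (auto simp del: of_nat_add of_nat_mult)
  \<comment> \<open>The quadratic order pays off here: \<open>(2 * k + 3)\<^sup>2\<close> exceeds
    \<open>k * (2 * k + 1)\<close>.\<close>
  also have "\<dots> < real (graph_order k)"
    unfolding of_nat_mult[symmetric] of_nat_less_iff
    by (simp add: graph_order_def power2_eq_square algebra_simps)
  finally show False by simp
qed

section \<open>The fooling set\<close>

text \<open>Silence is recorded as \<open>None\<close>, also after termination, so transcripts of
  runs of different lengths can be compared at a common length \<open>R\<close>.\<close>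

definition transcript :: "'s algorithm \<Rightarrow> dsf_instance \<Rightarrow> nat \<Rightarrow> (bool list option \<times> bool list option) list" where
  "transcript A I R = map (\<lambda>r. (sent A I (states A I r) 0 1, sent A I (states A I r) 1 0)) [0..<R]"

text \<open>Cut and paste: on the mixed input, node 0 runs as in the first instance and all others
  as in the second, because neither side can notice the exchange of the other. States at round
  \<open>r\<close> depend only on messages of earlier rounds, so \<open>r = R\<close> is
  included.\<close>

lemma states_mixed_instance:
  assumes TT': "T \<subseteq> leaves k" "T' \<subseteq> leaves k"
    and eq: "transcript A (disj_instance k S T) R = transcript A (disj_instance k S' T') R"
    and "r \<le> R"
  shows "states A (disj_instance k S T') r 0 = states A (disj_instance k S T) r 0 \<and>
         (\<forall>v \<noteq> 0. states A (disj_instance k S T') r v = states A (disj_instance k S' T') r v)"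
  using assms(4)
proof (induction r)
  case 0
  have "node_view_of (disj_instance k S T') 0 = node_view_of (disj_instance k S T) 0"
    unfolding node_view_of_def zero_edge_iff[OF TT'(1)] zero_edge_iff[OF TT'(2)]
    by (simp cong: if_cong)
  moreover have "node_view_of (disj_instance k S T') v = node_view_of (disj_instance k S' T') v"
    if "v \<noteq> 0" for v
    using that by (simp add: node_view_of_def cong: if_cong)
  ultimately show ?case by simp
next
  case (Suc r)
  let ?X = "disj_instance k S T'" and ?I = "disj_instance k S T" and ?J = "disj_instance k S' T'"
  have IH: "states A ?X r 0 = states A ?I r 0"
      "\<And>v. v \<noteq> 0 \<Longrightarrow> states A ?X r v = states A ?J r v"
    using Suc by auto
  have tr: "sent A ?I (states A ?I r) 0 1 = sent A ?J (states A ?J r) 0 1"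
      "sent A ?I (states A ?I r) 1 0 = sent A ?J (states A ?J r) 1 0"
    using eq Suc.prems unfolding transcript_def by auto
  have edges_X: "edges ?X = edges ?J" by simp
  note zero = zero_edge_iff[OF TT'(1)] zero_edge_iff[OF TT'(2)]
  \<comment> \<open>Node 0 hears only node 1, which acts as in \<open>?J\<close> by induction; the
    equal transcripts turn this message into the one of \<open>?I\<close>.\<close>
  have to_zero: "sent A ?X (states A ?X r) u 0 = sent A ?I (states A ?I r) u 0" for u
  proof (cases "u = 1")
    case True
    have "sent A ?X (states A ?X r) 1 0 = sent A ?J (states A ?J r) 1 0"
      unfolding sent_def zero using IH(2)[of 1] by simp
    with True tr(2) show ?thesis by simp
  next
    case False
    then show ?thesis unfolding sent_def zero by simp
  qed
  \<comment> \<open>Dually, node 0 acts as in \<open>?I\<close>, and the transcripts turn its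
    message into the one of \<open>?J\<close>.\<close>
  have from_zero: "sent A ?X (states A ?X r) 0 v = sent A ?J (states A ?J r) 0 v" for v
  proof (cases "v = 1")
    case True
    have "sent A ?X (states A ?X r) 0 1 = sent A ?I (states A ?I r) 0 1"
      unfolding sent_def zero using IH(1) by simp
    with True tr(1) show ?thesis by simp
  next
    case False
    then show ?thesis unfolding sent_def zero by simp
  qed
  have from_any: "sent A ?X (states A ?X r) u v = sent A ?J (states A ?J r) u v" for u v
  proof (cases "u = 0")
    case True
    then show ?thesis using from_zero by simp
  next
    case False
    then show ?thesis unfolding sent_def edges_X by (simp add: IH(2) del: disj_instance_simps)
  qed
  have "states A ?X (Suc r) 0 = states A ?I (Suc r) 0"
    by (simp only: states.simps IH(1) to_zero)
  moreover have "states A ?X (Suc r) v = states A ?J (Suc r) v" if "v \<noteq> 0" for v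
    by (simp only: states.simps IH(2)[OF that] from_any)
  ultimately show ?case by blast
qed

text \<open>An element of \<open>S\<close> outside \<open>S'\<close> would make the heavy edge
  necessary on the mixed instance. But node 1, an endpoint of that edge, decides there as in the
  second instance, where it leaves the edge out.\<close>

lemma same_transcript_subset:
  assumes S: "S \<subseteq> leaves k" "S' \<subseteq> leaves k"
    and approx: "finite_approx_ratio a d A" "1 \<le> a" "1 \<le> d"
    and eq: "transcript A (disj_instance k S (leaves k - S)) R
           = transcript A (disj_instance k S' (leaves k - S')) R"
    and comp: "computes A (disj_instance k S' (leaves k - S')) F" "{1, 2} \<notin> F"
    and R: "rounds A (disj_instance k S' (leaves k - S')) \<le> R"
  shows "S \<subseteq> S'"
proof
  fix v assume "v \<in> S"
  let ?J = "disj_instance k S' (leaves k - S')" and ?X = "disj_instance k S (leaves k - S')"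
  have one: "1 < graph_order k" using graph_order_ge[of k] by simp
  obtain F' where F': "computes A ?X F'" "solution ?X F'"
    using approx dsf_cr_disj_instance[OF approx(2,3) S(1), of "leaves k - S'"]
    unfolding finite_approx_ratio_def by blast
  have "states A ?X R 1 = states A ?J R 1"
    using states_mixed_instance[OF _ _ eq order_refl] by auto
  moreover have "result A (states A ?J R 1) = Some {w. {1, w} \<in> F}"
    using computes_result_after_rounds[OF comp(1) _ R] one by simp
  \<comment> \<open>\<open>R\<close> bounds the rounds on \<open>?J\<close>, not those on
    \<open>?X\<close>; it suffices that node 1 itself has an output by round
    \<open>R\<close>.\<close>
  ultimately have "{w. {1, w} \<in> F} = {w. {1, w} \<in> F'}"
    using computes_result[OF F'(1), of 1 R] one by simp
  with comp(2) have "{1, 2} \<notin> F'" by blast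
  with heavy_edge_necessary[OF S(1) _ \<open>v \<in> S\<close> _ F'(2)] \<open>v \<in> S\<close> S(1) show "v \<in> S'" by blast
qed

section \<open>Counting transcripts\<close>

definition messages :: "nat \<Rightarrow> bool list option set" where
  "messages L = insert None (Some ` {m. length m \<le> L})"

lemma finite_messages: "finite (messages L)"
  using finite_lists_length_le[of "UNIV :: bool set" L] by (simp add: messages_def)

text \<open>There are \<open>2 ^ (L + 1) - 1\<close> bit strings of length at most \<open>L\<close>;
  silence completes the power of two.\<close>

lemma card_messages: "card (messages L) = 2 ^ (L + 1)"
proof -
  have "finite {m :: bool list. length m \<le> L}"
    using finite_lists_length_le[of "UNIV :: bool set" L] by simp
  moreover have "card {m :: bool list. length m \<le> L} = 2 ^ (L + 1) - 1"
    using card_lists_length_le[of "UNIV :: bool set" L] sum_power2[of "L + 1"]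
    by (simp add: atLeast0LessThan lessThan_Suc_atMost)
  moreover have "card (messages L) = Suc (card {m :: bool list. length m \<le> L})"
    unfolding messages_def using calculation(1)
    by (subst card_insert_disjoint) (auto simp: card_image)
  ultimately show ?thesis by simp
qed

text \<open>If all the \<open>2 ^ k\<close> complementary pairs were solved faster, there would be
  fewer than \<open>2 ^ k\<close> transcripts, and two different pairs would share one.\<close>

lemma many_rounds_instance:
  fixes \<rho> :: real
  assumes ad: "1 \<le> a" "1 \<le> d"
    and approx: "\<And>I. dsf_cr_instance a d I \<Longrightarrow>
        \<exists>F. computes A I F \<and> solution I F \<and> real (total_weight I F) \<le> \<rho> * real (opt_weight I)"
    and "\<rho> \<le> real k"
    and msg: "\<And>S T r u v m. S \<subseteq> leaves k \<Longrightarrow> T \<subseteq> leaves k \<Longrightarrow> u < graph_order k \<Longrightarrow> v < graph_order k \<Longrightarrow>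
        sent A (disj_instance k S T) (states A (disj_instance k S T) r) u v = Some m \<Longrightarrow>
        length m \<le> L"
  shows "\<exists>S\<subseteq>leaves k. k \<le> 2 * (L + 1) * rounds A (disj_instance k S (leaves k - S))"
proof (rule ccontr)
  let ?I = "\<lambda>S. disj_instance k S (leaves k - S)"
  assume "\<not> ?thesis"
  then have few: "2 * (L + 1) * rounds A (?I S) < k" if "S \<subseteq> leaves k" for S
    using that by (meson not_le)
  \<comment> \<open>A common length for all transcripts. The maximum is attained, so it inherits the
    strict bound \<open>few\<close>.\<close>
  define R where "R = Max ((\<lambda>S. rounds A (?I S)) ` Pow (leaves k))"
  have fin: "finite (Pow (leaves k))" by (simp add: leaves_def)
  have R: "rounds A (?I S) \<le> R" if "S \<subseteq> leaves k" for S
    unfolding R_def using that fin by (intro Max_ge) auto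
  have "R \<in> (\<lambda>S. rounds A (?I S)) ` Pow (leaves k)"
    unfolding R_def using fin by (intro Max_in) auto
  with few have R_less: "2 * (L + 1) * R < k" by auto
  let ?tr = "\<lambda>S. transcript A (?I S) R"
  let ?M = "messages L \<times> messages L"
  have one: "0 < graph_order k" "1 < graph_order k" using graph_order_ge[of k] by auto
  have "?tr ` Pow (leaves k) \<subseteq> {xs. set xs \<subseteq> ?M \<and> length xs = R}"
  proof (clarsimp simp: transcript_def)
    fix S r assume "S \<subseteq> leaves k"
    then have "sent A (?I S) (states A (?I S) r) u v \<in> messages L"
      if "u < graph_order k" "v < graph_order k" for u v
      using msg[of S "leaves k - S" u v r] that
      by (cases "sent A (?I S) (states A (?I S) r) u v") (auto simp: messages_def)
    with one show "sent A (?I S) (states A (?I S) r) 0 (Suc 0) \<in> messages L \<and>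
        sent A (?I S) (states A (?I S) r) (Suc 0) 0 \<in> messages L"
      by simp
  qed
  then have "card (?tr ` Pow (leaves k)) \<le> card {xs. set xs \<subseteq> ?M \<and> length xs = R}"
    by (intro card_mono finite_lists_length_eq) (simp_all add: finite_messages)
  also have "\<dots> = card ?M ^ R"
    by (intro card_lists_length_eq) (simp add: finite_messages)
  \<comment> \<open>Each round contributes two messages, one per direction, of \<open>L + 1\<close>
    bits of choice each.\<close>
  also have "\<dots> = 2 ^ (2 * (L + 1) * R)"
    by (simp only: card_cartesian_product card_messages power_add[symmetric] power_mult[symmetric]
        mult_2)
  also have "\<dots> < 2 ^ k" using R_less by (intro power_strict_increasing) auto
  also have "\<dots> = card (Pow (leaves k))" by (simp add: card_Pow leaves_def)
  finally have "\<not> inj_on ?tr (Pow (leaves k))" by (rule pigeonhole)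
  then obtain S S' where S: "S \<subseteq> leaves k" "S' \<subseteq> leaves k" "S \<noteq> S'" "?tr S = ?tr S'"
    unfolding inj_on_def by blast
  \<comment> \<open>A set and its complement are disjoint, so the approximation ratio rules out the
    heavy edge.\<close>
  have "\<exists>F. computes A (?I S) F \<and> {1, 2} \<notin> F" if "S \<subseteq> leaves k" for S
    using approx[OF dsf_cr_disj_instance[OF ad that, of "leaves k - S"]]
      heavy_edge_avoided[OF that _ _ \<open>\<rho> \<le> real k\<close>, of "leaves k - S"] by blast
  then obtain F F' where F: "computes A (?I S) F" "{1, 2} \<notin> F"
    and F': "computes A (?I S') F'" "{1, 2} \<notin> F'"
    using S(1,2) by meson
  have ratio: "finite_approx_ratio a d A"
    unfolding finite_approx_ratio_def using approx by blast
  have "S \<subseteq> S'"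
    by (rule same_transcript_subset[OF S(1,2) ratio ad S(4) F' R[OF S(2)]])
  moreover have "S' \<subseteq> S"
    by (rule same_transcript_subset[OF S(2,1) ratio ad S(4)[symmetric] F R[OF S(1)]])
  ultimately show False using S(3) by simp
qed

section \<open>Choice of the family and its asymptotics\<close>

theorem lemma3p1:
  fixes A :: "'s algorithm" and a d :: nat
  assumes "1 \<le> a" and "1 \<le> d"
    and "congest_algorithm a d A"
    and "finite_approx_ratio a d A"
  shows "\<exists>I :: nat \<Rightarrow> dsf_instance.
    (\<forall>k. dsf_cr_instance a d (I k) \<and> hop_diameter (I k) \<le> 4 \<and>
         card (input_components (I k)) \<le> 2) \<and>
    filterlim (\<lambda>k. real (num_terminals (I k)) / log 2 (real (num_nodes (I k))))
      at_top sequentially \<and>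
    (\<lambda>k. real (rounds A (I k))) \<in>
      \<Omega>(\<lambda>k. real (num_terminals (I k)) / log 2 (real (num_nodes (I k))))"
proof -
  obtain c :: real where c: "\<And>I r u v m. dsf_cr_instance a d I \<Longrightarrow> u \<in> nodes I \<Longrightarrow> v \<in> nodes I \<Longrightarrow>
      sent A I (states A I r) u v = Some m \<Longrightarrow> real (length m) \<le> c * log 2 (real (num_nodes I))"
    using assms(3) unfolding congest_algorithm_def by blast
  obtain \<rho> :: real where \<rho>: "\<And>I. dsf_cr_instance a d I \<Longrightarrow>
      \<exists>F. computes A I F \<and> solution I F \<and> real (total_weight I F) \<le> \<rho> * real (opt_weight I)"
    using assms(4) unfolding finite_approx_ratio_def by blast
  define l where "l k = log 2 (real (graph_order k))" for k
  have l: "1 \<le> l k" for k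
    using graph_order_ge[of k] by (simp add: l_def le_log_iff)
  \<comment> \<open>The sign of \<open>c\<close> is arbitrary; the absolute value keeps the bound
    nonnegative. Rounding down is harmless because lengths are integers.\<close>
  define L where "L k = nat \<lfloor>\<bar>c\<bar> * l k\<rfloor>" for k
  have msg: "length m \<le> L k" if "S \<subseteq> leaves k" "T \<subseteq> leaves k" "u < graph_order k" "v < graph_order k"
    "sent A (disj_instance k S T) (states A (disj_instance k S T) r) u v = Some m" for k S T r u v m
  proof -
    have "real (length m) \<le> c * l k"
      using c[OF dsf_cr_disj_instance[OF assms(1,2) that(1,2)] _ _ that(5)] that(3,4)
      by (simp add: l_def)
    also have "\<dots> \<le> \<bar>c\<bar> * l k" using l[of k] by (intro mult_right_mono) auto
    finally show ?thesis by (simp add: L_def le_nat_floor)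
  qed
  \<comment> \<open>The implication stands inside the existential so that a set is chosen for small
    \<open>k\<close> as well; every member of the family must be a valid instance.\<close>
  have "\<exists>S\<subseteq>leaves k. \<rho> \<le> real k \<longrightarrow>
      k \<le> 2 * (L k + 1) * rounds A (disj_instance k S (leaves k - S))" for k
  proof (cases "\<rho> \<le> real k")
    case True
    have "\<exists>S\<subseteq>leaves k. k \<le> 2 * (L k + 1) * rounds A (disj_instance k S (leaves k - S))"
      using assms(1,2) \<rho> True msg by (rule many_rounds_instance)
    then show ?thesis by blast
  qed auto
  then obtain S where S: "\<And>k. S k \<subseteq> leaves k"
    and long: "\<And>k. \<rho> \<le> real k \<Longrightarrow>
      k \<le> 2 * (L k + 1) * rounds A (disj_instance k (S k) (leaves k - S k))"
    by metis
  define I where "I k = disj_instance k (S k) (leaves k - S k)" for k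
  have nodes: "log 2 (real (num_nodes (I k))) = l k" for k
    by (simp add: I_def l_def)
  \<comment> \<open>Squaring only doubles the logarithm, so \<open>l k\<close> still grows like the
    logarithm of \<open>k\<close>.\<close>
  have "filterlim (\<lambda>k. real k / l k) at_top sequentially"
    unfolding l_def graph_order_def by real_asymp
  moreover have "real k / l k \<le> real (num_terminals (I k)) / l k" for k
    using l[of k] num_terminals_bounds(1)[OF S] by (intro divide_right_mono) (auto simp: I_def)
  ultimately have lim: "filterlim (\<lambda>k. real (num_terminals (I k)) / l k) at_top sequentially"
    by (rule filterlim_at_top_mono[OF _ always_eventually[OF allI]])
  \<comment> \<open>The 6 is 2 for the two directions times 3 from
    \<open>2 * k + 1 \<le> 3 * k\<close>, where \<open>1 \<le> k\<close> enters. In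
    \<open>\<bar>c\<bar> + 1\<close>, the summand 1 absorbs the extra bit per message, as
    \<open>1 \<le> l k\<close>.\<close>
  have bound: "real (num_terminals (I k)) / l k \<le> 6 * (\<bar>c\<bar> + 1) * real (rounds A (I k))"
    if "\<rho> \<le> real k" "1 \<le> k" for k
  proof -
    have "real (L k) \<le> \<bar>c\<bar> * l k" using l[of k] by (simp add: L_def)
    with l[of k] have "real (L k) + 1 \<le> (\<bar>c\<bar> + 1) * l k" by (simp add: algebra_simps)
    then have "2 * (real (L k) + 1) * real (rounds A (I k))
        \<le> 2 * ((\<bar>c\<bar> + 1) * l k) * real (rounds A (I k))"
      by (intro mult_right_mono mult_left_mono) auto
    moreover have "real k \<le> 2 * (real (L k) + 1) * real (rounds A (I k))"
    proof -
      have "real k \<le> real (2 * (L k + 1) * rounds A (I k))"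
        unfolding of_nat_le_iff I_def by (rule long[OF that(1)])
      then show ?thesis by (simp add: algebra_simps)
    qed
    moreover have "real (num_terminals (I k)) \<le> 3 * real k"
    proof -
      have "num_terminals (I k) \<le> 3 * k"
        using num_terminals_bounds(2)[OF S[of k], of "leaves k - S k"] that(2) unfolding I_def
        by linarith
      then show ?thesis by linarith
    qed
    ultimately have "real (num_terminals (I k))
        \<le> 3 * (2 * ((\<bar>c\<bar> + 1) * l k) * real (rounds A (I k)))"
      by linarith
    also have "\<dots> = 6 * (\<bar>c\<bar> + 1) * real (rounds A (I k)) * l k" by simp
    finally have "real (num_terminals (I k)) \<le> 6 * (\<bar>c\<bar> + 1) * real (rounds A (I k)) * l k" .
    then show ?thesis using l[of k] by (simp add: pos_divide_le_eq)
  qed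
  have "\<forall>\<^sub>F k in sequentially. \<rho> \<le> real k \<and> 1 \<le> k"
    by (intro eventually_conj eventually_ge_at_top) real_asymp
  then have "\<forall>\<^sub>F k in sequentially. real (num_terminals (I k)) / l k
      \<le> 6 * (\<bar>c\<bar> + 1) * real (rounds A (I k))"
    by (rule eventually_mono) (use bound in blast)
  moreover have "norm (real (num_terminals (I k)) / l k) = real (num_terminals (I k)) / l k" for k
    using l[of k] by simp
  ultimately have "(\<lambda>k. real (num_terminals (I k)) / l k) \<in> O(\<lambda>k. real (rounds A (I k)))"
    by (intro bigoI[where c = "6 * (\<bar>c\<bar> + 1)"]) (simp only: norm_of_nat)
  then have "(\<lambda>k. real (rounds A (I k))) \<in> \<Omega>(\<lambda>k. real (num_terminals (I k)) / l k)"
    by (simp only: bigomega_iff_bigo)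
  moreover have "dsf_cr_instance a d (I k) \<and> hop_diameter (I k) \<le> 4 \<and>
      card (input_components (I k)) \<le> 2" for k
    unfolding I_def
    using dsf_cr_disj_instance[OF assms(1,2) S Diff_subset] hop_diameter_disj_instance[OF Diff_subset]
      input_components_disj_instance
    by blast
  ultimately show ?thesis
    using lim unfolding nodes[symmetric] by blast
qed

end
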